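(* Let $q$ be a prime power, $2\le n\le m$, let $C\subseteq\mathbb{F}_{q^m}^n$ be a vector rank-metric code, and let $\Gamma,\Gamma'$ be $\mathbb{F}_q$-bases of $\mathbb{F}_{q^m}$. Then $P(\Gamma(C),\mathrm c)=P(\Gamma'(C),\mathrm c)$ and $P(\Gamma(C),\mathrm r)\sim P(\Gamma'(C),\mathrm r)$.
   Context: A vector rank-metric code is an $\mathbb{F}_{q^m}$-linear subspace of $\mathbb{F}_{q^m}^n$. For an $\mathbb{F}_q$-basis $\Gamma=\{\gamma_1,\dots,\gamma_m\}$ of $\mathbb{F}_{q^m}$ and $v\in\mathbb{F}_{q^m}^n$, $\Gamma(v)$ is the unique $n\times m$ matrix over $\mathbb{F}_q$ with $v_i=\sum_j\Gamma(v)_{ij}\gamma_j$, and $\Gamma(C)=\{\Gamma(v)\mid v\in C\}$, an $\mathbb{F}_q$-linear subspace of the space $\mathrm{Mat}$ of $n\times m$ matrices over $\mathbb{F}_q$. For such a subspace $\mathcal{C}$ and subspaces $J\subseteq\mathbb{F}_q^n$, $K\subseteq\mathbb{F}_q^m$: $\mathcal{C}(J,\mathrm c)=\{M\in\mathcal{C}\mid\mathrm{colsp}(M)\subseteq J\}$, $\mathcal{C}(K,\mathrm r)=\{M\in\mathcal{C}\mid\mathrm{rowsp}(M)\subseteq K\}$, $\rho_{\mathrm c}(\mathcal{C},J)=(\dim\mathcal{C}-\dim\mathcal{C}(J^\perp,\mathrm c))/m$, $\rho_{\mathrm r}(\mathcal{C},K)=(\dim\mathcal{C}-\dim\mathcal{C}(K^\perp,\mathrm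 r))/n$ ($\perp$ for the standard inner product); $P(\mathcal{C},\mathrm c)=(\mathbb{F}_q^n,\rho_{\mathrm c}(\mathcal{C},\cdot))$, $P(\mathcal{C},\mathrm r)=(\mathbb{F}_q^m,\rho_{\mathrm r}(\mathcal{C},\cdot))$. Two pairs $(\mathbb{F}_q^N,\rho_1)$, $(\mathbb{F}_q^N,\rho_2)$ are equivalent ($\sim$) if there is an $\mathbb{F}_q$-linear isomorphism $\varphi$ of $\mathbb{F}_q^N$ with $\rho_1(A)=\rho_2(\varphi(A))$ for all subspaces $A$. *)

theory Defs
  imports "HOL-Analysis.Analysis"
begin

text \<open>F_q is a finite field type 'k, F_{q^m} a field type 'K, with the inclusion
  F_q into F_{q^m} given by a ring homomorphism emb. An F_q-basis of F_{q^m} is indexed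
  by a finite type 'm with CARD('m) = m. Vectors of F_q^n are 'k^'n; n x m matrices
  over F_q are 'k^('n \<times> 'm), entry (i,j) being M$(i,j).\<close>

definition is_Fq_basis :: "('k::field \<Rightarrow> 'K::field) \<Rightarrow> ('m::finite \<Rightarrow> 'K) \<Rightarrow> bool" where
  "is_Fq_basis emb \<gamma> \<longleftrightarrow> (\<forall>x. \<exists>!c::'k^'m. x = (\<Sum>j\<in>UNIV. emb (c$j) * \<gamma> j))"

definition Gamma_vec :: "('k::field \<Rightarrow> 'K::field) \<Rightarrow> ('m::finite \<Rightarrow> 'K) \<Rightarrow> 'K^'n::finite \<Rightarrow> 'k^('n \<times> 'm)" where
  "Gamma_vec emb \<gamma> v = (\<chi> p. (THE c::'k^'m. v$(fst p) = (\<Sum>j\<in>UNIV. emb (c$j) * \<gamma> j)) $ (snd p))"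

definition Gamma_code :: "('k::field \<Rightarrow> 'K::field) \<Rightarrow> ('m::finite \<Rightarrow> 'K) \<Rightarrow> ('K^'n::finite) set \<Rightarrow> ('k^('n \<times> 'm)) set" where
  "Gamma_code emb \<gamma> C = Gamma_vec emb \<gamma> ` C"

definition colsp :: "'k::field^('n::finite \<times> 'm::finite) \<Rightarrow> ('k^'n) set" where
  "colsp M = vec.span (range (\<lambda>j::'m. \<chi> i::'n. M$(i,j)))"

definition rowsp :: "'k::field^('n::finite \<times> 'm::finite) \<Rightarrow> ('k^'m) set" where
  "rowsp M = vec.span (range (\<lambda>i::'n. \<chi> j::'m. M$(i,j)))"

text \<open>Orthogonal complement w.r.t. the standard bilinear form.\<close>
definition orth :: "('k::field^'n::finite) set \<Rightarrow> ('k^'n) set" where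
  "orth J = {x. \<forall>y\<in>J. (\<Sum>i\<in>UNIV. x$i * y$i) = 0}"

definition code_c :: "('k::field^('n::finite \<times> 'm::finite)) set \<Rightarrow> ('k^'n) set \<Rightarrow> ('k^('n \<times> 'm)) set" where
  "code_c Cm J = {M \<in> Cm. colsp M \<subseteq> J}"

definition code_r :: "('k::field^('n::finite \<times> 'm::finite)) set \<Rightarrow> ('k^'m) set \<Rightarrow> ('k^('n \<times> 'm)) set" where
  "code_r Cm K = {M \<in> Cm. rowsp M \<subseteq> K}"

definition rho_c :: "('k::field^('n::finite \<times> 'm::finite)) set \<Rightarrow> ('k^'n) set \<Rightarrow> real" where
  "rho_c Cm J = (real (vec.dim Cm) - real (vec.dim (code_c Cm (orth J)))) / real CARD('m)"

definition rho_r :: "('k::field^('n::finite \<times> 'm::finite)) set \<Rightarrow> ('k^'m) set \<Rightarrow> real" where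
  "rho_r Cm K = (real (vec.dim Cm) - real (vec.dim (code_r Cm (orth K)))) / real CARD('n)"

text \<open>Equivalence of pairs (F_q^N, rho1), (F_q^N, rho2); rho's are considered on subspaces.\<close>
definition pair_equiv :: "(('k::field^'N::finite) set \<Rightarrow> real) \<Rightarrow> (('k^'N) set \<Rightarrow> real) \<Rightarrow> bool" where
  "pair_equiv \<rho>1 \<rho>2 \<longleftrightarrow> (\<exists>\<phi>. Vector_Spaces.linear (*s) (*s) \<phi> \<and> bij \<phi> \<and>
      (\<forall>A. vec.subspace A \<longrightarrow> \<rho>1 A = \<rho>2 (\<phi> ` A)))"

end

theory Submission
  imports Defs
begin

text \<open>Writing the coordinates of an element of F_{q^m} in the basis \<gamma>' instead of \<gamma> is an
  invertible F_q-linear map L of F_q^m, and \<Gamma>'(v) arises from \<Gamma>(v) by applying L to every row,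
  i.e. by multiplying from the right with an invertible matrix. Such a multiplication leaves the
  column space of every matrix in a subspace J fixed, so the column parameters agree. It maps
  the row space R to L(R), and x \<in> orth A iff L x \<in> orth (\<phi> A) for the adjoint \<phi> of the
  inverse of L; hence \<phi> is the required equivalence of the row parameters.\<close>

definition basis_comb :: "('k::field \<Rightarrow> 'K::field) \<Rightarrow> ('m::finite \<Rightarrow> 'K) \<Rightarrow> 'k^'m \<Rightarrow> 'K" where
  "basis_comb emb \<gamma> c = (\<Sum>j\<in>UNIV. emb (c$j) * \<gamma> j)"

definition basis_coord :: "('k::field \<Rightarrow> 'K::field) \<Rightarrow> ('m::finite \<Rightarrow> 'K) \<Rightarrow> 'K \<Rightarrow> 'k^'m" where
  "basis_coord emb \<gamma> x = (THE c. x = basis_comb emb \<gamma> c)"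

definition basis_change ::
    "('k::field \<Rightarrow> 'K::field) \<Rightarrow> ('m::finite \<Rightarrow> 'K) \<Rightarrow> ('m \<Rightarrow> 'K) \<Rightarrow> 'k^'m \<Rightarrow> 'k^'m" where
  "basis_change emb \<gamma> \<gamma>' c = basis_coord emb \<gamma>' (basis_comb emb \<gamma> c)"

lemma
  assumes "is_Fq_basis emb \<gamma>"
  shows basis_comb_coord: "basis_comb emb \<gamma> (basis_coord emb \<gamma> x) = x"
    and basis_coord_comb: "basis_coord emb \<gamma> (basis_comb emb \<gamma> c) = c"
proof -
  have unique: "\<exists>!c. y = basis_comb emb \<gamma> c" for y
    using assms unfolding is_Fq_basis_def basis_comb_def by blast
  show "basis_comb emb \<gamma> (basis_coord emb \<gamma> x) = x"
    unfolding basis_coord_def using theI'[OF unique] by simp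
  show "basis_coord emb \<gamma> (basis_comb emb \<gamma> c) = c"
    unfolding basis_coord_def by (rule the1_equality[OF unique refl])
qed

lemma basis_comb_add:
  assumes "\<forall>a b. emb (a + b) = emb a + emb b"
  shows "basis_comb emb \<gamma> (c + d) = basis_comb emb \<gamma> c + basis_comb emb \<gamma> d"
  unfolding basis_comb_def using assms by (simp add: distrib_right sum.distrib)

lemma basis_comb_scale:
  assumes "\<forall>a b. emb (a * b) = emb a * emb b"
  shows "basis_comb emb \<gamma> (a *s c) = emb a * basis_comb emb \<gamma> c"
  unfolding basis_comb_def using assms by (simp add: sum_distrib_left mult.assoc)

lemma basis_coord_add:
  assumes "is_Fq_basis emb \<gamma>" "\<forall>a b. emb (a + b) = emb a + emb b"
  shows "basis_coord emb \<gamma> (x + y) = basis_coord emb \<gamma> x + basis_coord emb \<gamma> y"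
  by (metis assms basis_comb_add basis_comb_coord basis_coord_comb)

lemma basis_coord_scale:
  assumes "is_Fq_basis emb \<gamma>" "\<forall>a b. emb (a * b) = emb a * emb b"
  shows "basis_coord emb \<gamma> (emb a * x) = a *s basis_coord emb \<gamma> x"
  by (metis assms basis_comb_scale basis_comb_coord basis_coord_comb)

lemma basis_change_linear:
  assumes "is_Fq_basis emb \<gamma>'"
    and "\<forall>a b. emb (a + b) = emb a + emb b" and "\<forall>a b. emb (a * b) = emb a * emb b"
  shows "Vector_Spaces.linear (*s) (*s) (basis_change emb \<gamma> \<gamma>')"
  unfolding Vector_Spaces.linear_iff basis_change_def
  using assms by (simp add: vec.vector_space_axioms basis_comb_add basis_comb_scale
      basis_coord_add basis_coord_scale)

lemma basis_change_inverse:
  assumes "is_Fq_basis emb \<gamma>" "is_Fq_basis emb \<gamma>'"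
  shows "basis_change emb \<gamma>' \<gamma> (basis_change emb \<gamma> \<gamma>' c) = c"
  unfolding basis_change_def using assms by (simp add: basis_comb_coord basis_coord_comb)

definition mat_row :: "'k^('n::finite \<times> 'm::finite) \<Rightarrow> 'n \<Rightarrow> 'k^'m" where
  "mat_row M i = (\<chi> j. M$(i,j))"

definition mat_col :: "'k^('n::finite \<times> 'm::finite) \<Rightarrow> 'm \<Rightarrow> 'k^'n" where
  "mat_col M j = (\<chi> i. M$(i,j))"

definition map_rows :: "('k^'m::finite \<Rightarrow> 'k^'p::finite) \<Rightarrow> 'k^('n::finite \<times> 'm) \<Rightarrow> 'k^('n \<times> 'p)" where
  "map_rows L M = (\<chi> ij. L (mat_row M (fst ij)) $ snd ij)"

lemma mat_eq_iff_rows: "M = N \<longleftrightarrow> (\<forall>i. mat_row M i = mat_row N i)"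
  unfolding mat_row_def vec_eq_iff by auto

lemma mat_row_map_rows [simp]: "mat_row (map_rows L M) i = L (mat_row M i)"
  by (simp add: mat_row_def map_rows_def vec_eq_iff)

lemma mat_row_add [simp]: "mat_row (M + N) i = mat_row M i + mat_row N i"
  by (simp add: mat_row_def vec_eq_iff)

lemma mat_row_scale [simp]: "mat_row (c *s M) i = c *s mat_row M i"
  by (simp add: mat_row_def vec_eq_iff)

lemma colsp_eq_span_cols: "colsp M = vec.span (range (mat_col M))"
  unfolding colsp_def mat_col_def ..

lemma rowsp_eq_span_rows: "rowsp M = vec.span (range (mat_row M))"
  unfolding rowsp_def mat_row_def ..

lemma map_rows_linear:
  fixes L :: "'k::field^'m::finite \<Rightarrow> 'k^'p::finite"
  assumes "Vector_Spaces.linear (*s) (*s) L"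
  shows "Vector_Spaces.linear (*s) (*s) (map_rows L :: 'k^('n::finite \<times> 'm) \<Rightarrow> _)"
proof -
  interpret L: Vector_Spaces.linear "(*s)" "(*s)" L by fact
  show ?thesis unfolding Vector_Spaces.linear_iff
    by (simp add: vec.vector_space_axioms mat_eq_iff_rows L.add L.scale)
qed

lemma map_rows_inverse: "(\<And>c. L' (L c) = c) \<Longrightarrow> map_rows L' (map_rows L M) = M"
  by (simp add: mat_eq_iff_rows)

lemma map_rows_inj: "inj L \<Longrightarrow> inj (map_rows L)"
  by (rule injI) (simp add: mat_eq_iff_rows inj_eq)

lemma dim_map_rows_image:
  fixes L :: "'k::field^'m::finite \<Rightarrow> 'k^'p::finite" and S :: "('k^('n::finite \<times> 'm)) set"
  assumes "Vector_Spaces.linear (*s) (*s) L" "inj L"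
  shows "vec.dim (map_rows L ` S) = vec.dim S"
  using map_rows_linear[OF assms(1)] map_rows_inj[OF assms(2)]
  by (rule vec.dim_image_eq[OF _ inj_on_subset]) simp

lemma mat_col_map_rows:
  assumes "Vector_Spaces.linear (*s) (*s) L"
  shows "mat_col (map_rows L M) k = (\<Sum>j\<in>UNIV. L (axis j 1) $ k *s mat_col M j)"
  unfolding vec_eq_iff
proof
  fix i
  have "mat_col (map_rows L M) k $ i = (\<Sum>j\<in>UNIV. mat_row M i $ j * L (axis j 1) $ k)"
    unfolding Cartesian_Space.linear_componentwise[OF assms, symmetric]
    by (simp add: mat_col_def map_rows_def)
  then show "mat_col (map_rows L M) k $ i = (\<Sum>j\<in>UNIV. L (axis j 1) $ k *s mat_col M j) $ i"
    by (simp add: sum_component mat_col_def mat_row_def mult.commute)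
qed

lemma colsp_subset_iff_cols:
  assumes "vec.subspace J"
  shows "colsp M \<subseteq> J \<longleftrightarrow> range (mat_col M) \<subseteq> J"
  unfolding colsp_eq_span_cols
  using order_trans[OF vec.span_superset] vec.span_minimal[OF _ assms] by blast

lemma colsp_map_rows_subset:
  assumes "Vector_Spaces.linear (*s) (*s) L" "vec.subspace J" "colsp M \<subseteq> J"
  shows "colsp (map_rows L M) \<subseteq> J"
proof -
  have "mat_col M j \<in> J" for j
    using assms(2,3) colsp_subset_iff_cols by blast
  then have "mat_col (map_rows L M) k \<in> J" for k
    unfolding mat_col_map_rows[OF assms(1)]
    by (intro vec.subspace_sum[OF assms(2)] vec.subspace_scale[OF assms(2)])
  then show ?thesis
    using assms(2) colsp_subset_iff_cols by blast
qed

lemma rowsp_map_rows: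
  assumes "Vector_Spaces.linear (*s) (*s) L"
  shows "rowsp (map_rows L M) = L ` rowsp M"
proof -
  interpret L: Vector_Spaces.linear "(*s)" "(*s)" L by fact
  have "range (mat_row (map_rows L M)) = L ` range (mat_row M)"
    by auto
  then show ?thesis
    unfolding rowsp_eq_span_rows by (simp add: L.span_image)
qed

definition std_form :: "'k::comm_ring_1^'n::finite \<Rightarrow> 'k^'n \<Rightarrow> 'k" where
  "std_form x y = (\<Sum>i\<in>UNIV. x$i * y$i)"

definition transpose_map :: "('k::field^'m::finite \<Rightarrow> 'k^'p::finite) \<Rightarrow> 'k^'p \<Rightarrow> 'k^'m" where
  "transpose_map B a = (\<chi> i. std_form (B (axis i 1)) a)"

lemma orth_eq_std_form: "orth J = {x. \<forall>y\<in>J. std_form x y = 0}"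
  unfolding orth_def std_form_def ..

lemma orth_subspace: "vec.subspace (orth J)"
  unfolding vec.subspace_def orth_def
  by (auto simp: distrib_right sum.distrib mult.assoc simp flip: sum_distrib_left)

lemma std_form_axis: "std_form (axis k 1) a = a$k"
proof -
  have "std_form (axis k 1) a = (\<Sum>i\<in>UNIV. if i = k then a$i else 0)"
    unfolding std_form_def axis_def by (rule sum.cong) auto
  then show ?thesis
    by simp
qed

lemma std_form_transpose_map:
  assumes "Vector_Spaces.linear (*s) (*s) B"
  shows "std_form y (transpose_map B a) = std_form (B y) a"
proof -
  have "std_form y (transpose_map B a) = (\<Sum>i\<in>UNIV. \<Sum>j\<in>UNIV. y$i * (B (axis i 1) $ j * a$j))"
    by (simp add: std_form_def transpose_map_def sum_distrib_left)
  also have "\<dots> = (\<Sum>j\<in>UNIV. \<Sum>i\<in>UNIV. y$i * (B (axis i 1) $ j * a$j))"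
    by (rule sum.swap)
  also have "\<dots> = std_form (B y) a"
    unfolding std_form_def Cartesian_Space.linear_componentwise[OF assms, of y]
    by (simp add: sum_distrib_right mult.assoc)
  finally show ?thesis .
qed

lemma transpose_map_linear: "Vector_Spaces.linear (*s) (*s) (transpose_map B)"
  unfolding Vector_Spaces.linear_iff
  by (simp add: vec.vector_space_axioms transpose_map_def std_form_def vec_eq_iff
      distrib_left sum.distrib sum_distrib_left mult.left_commute)

lemma transpose_map_inverse:
  assumes "Vector_Spaces.linear (*s) (*s) B" "Vector_Spaces.linear (*s) (*s) B'"
    and "\<And>c. B' (B c) = c"
  shows "transpose_map B (transpose_map B' a) = a"
  unfolding vec_eq_iff
  using std_form_transpose_map[OF assms(1), of "axis _ 1"]
    std_form_transpose_map[OF assms(2), of "B (axis _ 1)"]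
  by (simp add: assms(3) std_form_axis)

lemma image_in_orth_transpose_map_iff:
  assumes "Vector_Spaces.linear (*s) (*s) L'" and "\<And>c. L' (L c) = c"
  shows "L x \<in> orth (transpose_map L' ` A) \<longleftrightarrow> x \<in> orth A"
  by (simp add: orth_eq_std_form std_form_transpose_map assms)

lemma code_c_map_rows:
  assumes "Vector_Spaces.linear (*s) (*s) L" "Vector_Spaces.linear (*s) (*s) L'"
    and "\<And>c. L' (L c) = c" and "vec.subspace J"
  shows "code_c (map_rows L ` Cm) J = map_rows L ` code_c Cm J"
proof -
  have "colsp (map_rows L M) \<subseteq> J \<longleftrightarrow> colsp M \<subseteq> J" for M
    using colsp_map_rows_subset[OF assms(1,4), of M]
      colsp_map_rows_subset[OF assms(2,4), of "map_rows L M"]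
    by (auto simp: map_rows_inverse assms(3))
  then show ?thesis
    unfolding code_c_def by auto
qed

lemma code_r_map_rows:
  assumes "Vector_Spaces.linear (*s) (*s) L" "Vector_Spaces.linear (*s) (*s) L'"
    and "\<And>c. L' (L c) = c"
  shows "code_r (map_rows L ` Cm) (orth (transpose_map L' ` A)) = map_rows L ` code_r Cm (orth A)"
proof -
  have "rowsp (map_rows L M) \<subseteq> orth (transpose_map L' ` A) \<longleftrightarrow> rowsp M \<subseteq> orth A" for M
    unfolding rowsp_map_rows[OF assms(1)]
    using image_in_orth_transpose_map_iff[OF assms(2,3)] by blast
  then show ?thesis
    unfolding code_r_def by auto
qed

lemma rho_c_map_rows:
  fixes Cm :: "('k::field^('n::finite \<times> 'm::finite)) set" and L :: "'k^'m \<Rightarrow> 'k^'m"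
  assumes "Vector_Spaces.linear (*s) (*s) L" "Vector_Spaces.linear (*s) (*s) L'"
    and "\<And>c. L' (L c) = c"
  shows "rho_c (map_rows L ` Cm) J = rho_c Cm J"
proof -
  have "inj L"
    by (metis assms(3) injI)
  then show ?thesis
    unfolding rho_c_def code_c_map_rows[OF assms orth_subspace]
    by (simp add: dim_map_rows_image assms(1))
qed

lemma rho_r_map_rows:
  fixes Cm :: "('k::field^('n::finite \<times> 'm::finite)) set" and L :: "'k^'m \<Rightarrow> 'k^'m"
  assumes "Vector_Spaces.linear (*s) (*s) L" "Vector_Spaces.linear (*s) (*s) L'"
    and "\<And>c. L' (L c) = c"
  shows "rho_r (map_rows L ` Cm) (transpose_map L' ` A) = rho_r Cm A"
proof -
  have "inj L"
    by (metis assms(3) injI)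
  then show ?thesis
    unfolding rho_r_def code_r_map_rows[OF assms]
    by (simp add: dim_map_rows_image assms(1))
qed

lemma mat_row_Gamma_vec: "mat_row (Gamma_vec emb \<gamma> v) i = basis_coord emb \<gamma> (v$i)"
  unfolding mat_row_def Gamma_vec_def basis_coord_def basis_comb_def by (simp add: vec_eq_iff)

lemma Gamma_vec_basis_change:
  assumes "is_Fq_basis emb \<gamma>"
  shows "Gamma_vec emb \<gamma>' v = map_rows (basis_change emb \<gamma> \<gamma>') (Gamma_vec emb \<gamma> v)"
  unfolding mat_eq_iff_rows
  by (simp add: mat_row_Gamma_vec basis_change_def basis_comb_coord assms)

theorem proposition5p9:
  fixes emb :: "'k::{field,finite} \<Rightarrow> 'K::{field,finite}"
    and \<gamma> \<gamma>' :: "'m::finite \<Rightarrow> 'K"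
    and C :: "('K^'n::finite) set"
  assumes hom_add: "\<forall>a b. emb (a + b) = emb a + emb b"
    and hom_mult: "\<forall>a b. emb (a * b) = emb a * emb b"
    and hom_one: "emb 1 = 1"
    and n2: "2 \<le> CARD('n)"
    and nm: "CARD('n) \<le> CARD('m)"
    and code: "vec.subspace C"
    and basis: "is_Fq_basis emb \<gamma>"
    and basis': "is_Fq_basis emb \<gamma>'"
  shows "(\<forall>J::('k^'n) set. vec.subspace J \<longrightarrow>
            rho_c (Gamma_code emb \<gamma> C) J = rho_c (Gamma_code emb \<gamma>' C) J)
         \<and> pair_equiv (rho_r (Gamma_code emb \<gamma> C)) (rho_r (Gamma_code emb \<gamma>' C))"
proof -
  define L where "L = basis_change emb \<gamma> \<gamma>'"
  define L' where "L' = basis_change emb \<gamma>' \<gamma>"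
  have lin: "Vector_Spaces.linear (*s) (*s) L" "Vector_Spaces.linear (*s) (*s) L'"
    unfolding L_def L'_def using basis_change_linear basis basis' hom_add hom_mult by blast+
  have inv: "\<And>c. L' (L c) = c" "\<And>c. L (L' c) = c"
    unfolding L_def L'_def using basis_change_inverse basis basis' by blast+
  have code_change: "Gamma_code emb \<gamma>' C = map_rows L ` Gamma_code emb \<gamma> C"
    unfolding Gamma_code_def image_image L_def
    by (rule image_cong[OF refl Gamma_vec_basis_change[OF basis]])
  have "bij (transpose_map L')"
  proof (rule o_bij)
    show "transpose_map L \<circ> transpose_map L' = id"
      using transpose_map_inverse[OF lin inv(1)] by auto
    show "transpose_map L' \<circ> transpose_map L = id"
      using transpose_map_inverse[OF lin(2,1) inv(2)] by auto
  qed
  then have "pair_equiv (rho_r (Gamma_code emb \<gamma> C)) (rho_r (Gamma_code emb \<gamma>' C))"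
    unfolding pair_equiv_def code_change
    using transpose_map_linear rho_r_map_rows[OF lin inv(1), symmetric] by blast
  moreover have "rho_c (Gamma_code emb \<gamma> C) J = rho_c (Gamma_code emb \<gamma>' C) J" for J
    unfolding code_change by (rule rho_c_map_rows[OF lin inv(1), symmetric])
  ultimately show ?thesis
    by blast
qed

end
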